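(* For every constant $s \geq 3$, the one-round bandwidth complexity of $\textsc{MemDetect}(K_s)$ under edge insertions is $\Omega(\log \log n)$. This lower bound holds even when restricted to bounded-degree dynamic networks (i.e., dynamic networks whose maximum degree is $O(1)$).
   Context: Dynamic network model: a dynamic network is a sequence of graphs $G^0, G^1, \ldots$ on $n$ nodes, where each $G^i$ ($i \ge 1$) is either identical to $G^{i-1}$ or obtained from it by a single topological change of the allowed type (here: only edge insertions). Nodes have distinct identifiers from $[n]$, each node knows the identifiers of its current neighbors, and every node initially knows the entire topology of $G^0$. Communication is synchronous: in each round the topological change (if any) happens first, then each node may send a $B$-bit message to each of its current neighbors; $B$ is the bandwidth. A node learns of changes only by comparing its neighbor list between consecutive rounds. Algorithms are deterministic. An $r$-round algorithm works under the promise that each topological change (at round $i$) is followed by at least $r-1$ rounds without changes, and must produce the correct output for $G^i$ by the end of round $i+r-1$; in particular a one-round algorithm must output correctly for $G^i$ at the end of round $i$ itself (after that round's communication). The $r$-round bandwidth complexity of a problem is the minimum $B$ (as a function of $n$) for which a deterministic $r$-round algorithm with bandwidth $B$ solving it exists. $\textsc{MemDetect}(H)$: every node $v$ must output whether $v$ belongs to at least one subgraph of the current graph isomorphic to $H$. $K_s$ denotes the clique on $s$ nodes. *)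

theory Defs
  imports Complex_Main "HOL-Library.Extended_Real"
begin

record 'a graph =
  verts :: "'a set"
  edges :: "'a set set"

definition simple_graph :: "'a graph \<Rightarrow> bool" where
  "simple_graph G \<longleftrightarrow> finite (verts G) \<and>
     (\<forall>e \<in> edges G. \<exists>u \<in> verts G. \<exists>v \<in> verts G. u \<noteq> v \<and> e = {u, v})"

definition neighbours :: "'a graph \<Rightarrow> 'a \<Rightarrow> 'a set" where
  "neighbours G v = {u. {u, v} \<in> edges G}"

definition insert_edge :: "'a \<Rightarrow> 'a \<Rightarrow> 'a graph \<Rightarrow> 'a graph" where
  "insert_edge u v G = G\<lparr>edges := insert {u, v} (edges G)\<rparr>"

definition subgraph :: "'a graph \<Rightarrow> 'a graph \<Rightarrow> bool" where
  "subgraph H G \<longleftrightarrow> simple_graph H \<and> verts H \<subseteq> verts G \<and> edges H \<subseteq> edges G"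

definition isomorphic :: "'a graph \<Rightarrow> 'b graph \<Rightarrow> bool" where
  "isomorphic G H \<longleftrightarrow> (\<exists>f. bij_betw f (verts G) (verts H) \<and>
     (\<forall>u \<in> verts G. \<forall>v \<in> verts G. {u, v} \<in> edges G \<longleftrightarrow> {f u, f v} \<in> edges H))"

definition complete_graph :: "nat \<Rightarrow> nat graph" where
  "complete_graph s =
     \<lparr>verts = {1..s}, edges = {{u, v} | u v. u \<in> {1..s} \<and> v \<in> {1..s} \<and> u \<noteq> v}\<rparr>"

definition mem_detect :: "'b graph \<Rightarrow> 'a graph \<Rightarrow> 'a \<Rightarrow> bool" where
  "mem_detect H G v \<longleftrightarrow> (\<exists>H'. subgraph H' G \<and> isomorphic H' H \<and> v \<in> verts H')"

text \<open>The \<open>n\<close> nodes carry distinct identifiers from \<open>{1..n}\<close>, so nodes are identified with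
  their identifiers.\<close>

type_synonym dynamic_network = "nat \<Rightarrow> nat graph"

definition insertion_networks :: "nat \<Rightarrow> dynamic_network set" where
  "insertion_networks n = {G. simple_graph (G 0) \<and> verts (G 0) = {1..n} \<and>
     (\<forall>i. G (Suc i) = G i \<or>
       (\<exists>u \<in> {1..n}. \<exists>v \<in> {1..n}. u \<noteq> v \<and> {u, v} \<notin> edges (G i) \<and>
          G (Suc i) = insert_edge u v (G i)))}"

definition max_degree_le :: "nat \<Rightarrow> dynamic_network \<Rightarrow> bool" where
  "max_degree_le \<Delta> G \<longleftrightarrow> (\<forall>i. \<forall>v \<in> verts (G i). card (neighbours (G i) v) \<le> \<Delta>)"

text \<open>\<open>None\<close> means that no message is sent.\<close>

type_synonym message = "bool list option"

text \<open>What a node observes in one round: its neighbours after the topological change, and the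
  messages received, indexed by sender.\<close>

type_synonym observation = "nat set \<times> (nat \<Rightarrow> message)"

text \<open>A deterministic node's behaviour is a function of everything it has seen so far, so local
  states need not be modelled: they are subsumed by the observation history, which lists
  the completed rounds in chronological order. In \<open>send_msg A v G0 h N u\<close>, node \<open>v\<close>, knowing the
  initial graph \<open>G0\<close>, its history \<open>h\<close> of the previous rounds and its neighbours \<open>N\<close> in the current
  round, chooses the message for its neighbour \<open>u\<close>. In \<open>node_output A v G0 h\<close> the history already
  includes the round at the end of which the output is given.\<close>

record algorithm =
  send_msg :: "nat \<Rightarrow> nat graph \<Rightarrow> observation list \<Rightarrow> nat set \<Rightarrow> nat \<Rightarrow> message"
  node_output :: "nat \<Rightarrow> nat graph \<Rightarrow> observation list \<Rightarrow> bool"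

text \<open>\<open>history A G i v\<close> is what \<open>v\<close> has observed in rounds \<open>1, \<dots>, i\<close> of the execution on \<open>G\<close>.\<close>

fun history :: "algorithm \<Rightarrow> dynamic_network \<Rightarrow> nat \<Rightarrow> nat \<Rightarrow> observation list" where
  "history A G 0 v = []"
| "history A G (Suc i) v = history A G i v @
     [(neighbours (G (Suc i)) v,
       \<lambda>u. if u \<in> neighbours (G (Suc i)) v
           then send_msg A u (G 0) (history A G i u) (neighbours (G (Suc i)) u) v
           else None)]"

text \<open>Messages shorter than \<open>B\<close> bits, and silence, are permitted; a lower bound for this generous
  model also applies when every message has exactly \<open>B\<close> bits.\<close>

definition has_bandwidth :: "nat \<Rightarrow> algorithm \<Rightarrow> bool" where
  "has_bandwidth B A \<longleftrightarrow> (\<forall>v G0 h N u m. send_msg A v G0 h N u = Some m \<longrightarrow> length m \<le> B)"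

text \<open>A one-round algorithm has to be correct for \<open>G i\<close> at the end of round \<open>i\<close>; the promise on the
  spacing of topological changes is void in this case.\<close>

definition one_round_solves ::
  "algorithm \<Rightarrow> (nat graph \<Rightarrow> nat \<Rightarrow> bool) \<Rightarrow> dynamic_network set \<Rightarrow> bool" where
  "one_round_solves A P \<G> \<longleftrightarrow>
     (\<forall>G \<in> \<G>. \<forall>i \<ge> 1. \<forall>v \<in> verts (G i). node_output A v (G 0) (history A G i v) \<longleftrightarrow> P (G i) v)"

text \<open>The minimum bandwidth; by convention infinite if no algorithm exists.\<close>

definition one_round_bandwidth ::
  "(nat graph \<Rightarrow> nat \<Rightarrow> bool) \<Rightarrow> dynamic_network set \<Rightarrow> enat" where
  "one_round_bandwidth P \<G> = Inf {enat B | B. \<exists>A. has_bandwidth B A \<and> one_round_solves A P \<G>}"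

text \<open>Landau's Omega for functions with values in \<open>enat\<close>, to which the library version does
  not apply.\<close>

definition enat_bigomega :: "(nat \<Rightarrow> enat) \<Rightarrow> (nat \<Rightarrow> real) \<Rightarrow> bool" where
  "enat_bigomega f g \<longleftrightarrow>
     (\<exists>c > 0. eventually (\<lambda>n. ereal (c * \<bar>g n\<bar>) \<le> ereal_of_enat (f n)) sequentially)"

end

(* Let r = s - 2. A node u is joined to all members of a clique V of size r that is present
   initially, later a node w is joined to V, and finally the edge uw is inserted, which completes a
   K_s. If w is joined during one of T periods, then w can only learn from its last round whether u
   is adjacent to V, and for T > 2^(B+1) the B-bit message of u does not determine the period in
   which V acquired its last neighbour. Hence w cannot distinguish this from an execution in which
   u was joined to a clique V', which acquired a neighbour w' in another period, while V was joined
   to a node u' instead of u. The identities of u', V' and w' are hidden by pigeonhole arguments: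
   in T periods at most O(TB) bits reach w from V, and u from V', so that 2^(O(B T^2)) nodes
   suffice. With T about 2^(B+1) this is doubly exponential in B. *)

theory Submission
  imports Defs "HOL-Library.Countable" "HOL-Library.FuncSet"
begin

section \<open>Executions\<close>

definition recv :: "algorithm \<Rightarrow> dynamic_network \<Rightarrow> nat \<Rightarrow> nat \<Rightarrow> nat \<Rightarrow> message" where
  "recv A G i v u =
     (if u \<in> neighbours (G (Suc i)) v
      then send_msg A u (G 0) (history A G i u) (neighbours (G (Suc i)) u) v
      else None)"

lemma history_Suc:
  "history A G (Suc i) v = history A G i v @ [(neighbours (G (Suc i)) v, recv A G i v)]"
  by (simp add: recv_def[abs_def])

text \<open>Information travels along edges only. If \<open>C\<close> is closed under neighbours
  during the first \<open>m\<close> rounds, nothing from outside reaches it. The initial graphs must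
  agree as a whole, since every node knows them.\<close>

lemma history_local:
  assumes "G 0 = H 0"
    and "\<And>i v. Suc i \<le> m \<Longrightarrow> v \<in> C \<Longrightarrow> neighbours (G (Suc i)) v = neighbours (H (Suc i)) v"
    and "\<And>i v. Suc i \<le> m \<Longrightarrow> v \<in> C \<Longrightarrow> neighbours (G (Suc i)) v \<subseteq> C"
    and "v \<in> C"
  shows "history A G m v = history A H m v"
  using assms(2-4)
proof (induction m arbitrary: v)
  case 0
  show ?case by simp
next
  case (Suc m)
  have IH: "history A G m u = history A H m u" if "u \<in> C" for u
    using Suc.IH[OF _ _ that] Suc.prems(1,2) by simp
  have N: "neighbours (G (Suc m)) u = neighbours (H (Suc m)) u" if "u \<in> C" for u
    using Suc.prems(1)[OF _ that] by simp
  have "recv A G m v u = recv A H m v u" for u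
  proof (cases "u \<in> neighbours (G (Suc m)) v")
    case True
    then have "u \<in> C" using Suc.prems(2)[of m v] Suc.prems(3) by auto
    then show ?thesis using True N[OF Suc.prems(3)] N IH assms(1) by (simp add: recv_def)
  next
    case False
    then show ?thesis using N[OF Suc.prems(3)] by (simp add: recv_def)
  qed
  then have "recv A G m v = recv A H m v" by blast
  then show ?case using IH[OF Suc.prems(3)] N[OF Suc.prems(3)] by (simp only: history_Suc)
qed

text \<open>A round adds to a history only the neighbour list and the messages received. From round
  \<open>m\<^sub>0\<close> on it thus suffices to compare these for one node, whatever happens
  elsewhere.\<close>

lemma history_eqI:
  assumes "history A G m\<^sub>0 v = history A H m\<^sub>0 v" and "m\<^sub>0 \<le> m"
    and "\<And>i. m\<^sub>0 \<le> i \<Longrightarrow> i < m \<Longrightarrow> neighbours (G (Suc i)) v = neighbours (H (Suc i)) v"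
    and "\<And>i. m\<^sub>0 \<le> i \<Longrightarrow> i < m \<Longrightarrow> neighbours (G (Suc i)) v \<subseteq> S"
    and "\<And>i u. m\<^sub>0 \<le> i \<Longrightarrow> i < m \<Longrightarrow> u \<in> S \<Longrightarrow> recv A G i v u = recv A H i v u"
  shows "history A G m v = history A H m v"
  using assms(2-5)
proof (induction m rule: dec_induct)
  case base
  show ?case by (rule assms(1))
next
  case (step m)
  have "recv A G m v u = recv A H m v u" for u
    using step.prems(1)[of m] step.prems(2)[of m] step.prems(3)[of m u] step.hyps
    by (cases "u \<in> S") (auto simp: recv_def)
  then have "recv A G m v = recv A H m v" by blast
  moreover have "history A G m v = history A H m v"
    using step.prems by (intro step.IH) auto
  ultimately show ?case using step.prems(1)[of m] step.hyps by (simp only: history_Suc)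
qed

definition messages :: "nat \<Rightarrow> message set" where
  "messages B = insert None (Some ` {m. length m \<le> B})"

lemma finite_messages: "finite (messages B)"
  using finite_lists_length_le[of "UNIV :: bool set" B] by (simp add: messages_def)

text \<open>There are \<open>2 ^ Suc B - 1\<close> bit strings of length at most \<open>B\<close>;
  silence is one more message.\<close>

lemma card_messages: "card (messages B) = 2 ^ Suc B"
proof -
  have fin: "finite {m :: bool list. length m \<le> B}"
    using finite_lists_length_le[of "UNIV :: bool set" B] by simp
  have "card {m :: bool list. length m \<le> B} = (\<Sum>i\<le>B. 2 ^ i)"
    using card_lists_length_le[of "UNIV :: bool set" B] by simp
  also have "\<dots> = 2 ^ Suc B - 1"
    by (induction B) auto
  finally have "card (Some ` {m :: bool list. length m \<le> B}) = 2 ^ Suc B - 1"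
    by (simp add: card_image)
  then show ?thesis using fin by (simp add: messages_def card_insert_if image_iff)
qed

lemma recv_in_messages: "has_bandwidth B A \<Longrightarrow> recv A G i v u \<in> messages B"
  unfolding has_bandwidth_def recv_def messages_def
  by (cases "send_msg A u (G 0) (history A G i u) (neighbours (G (Suc i)) u) v") auto

section \<open>Pigeonhole principles\<close>

text \<open>For each \<open>y\<close>, the points whose colour \<open>c y x\<close> no other point
  shares have distinct colours in \<open>Z y\<close>, so at most \<open>q\<close> points are
  excluded. Fewer than \<open>card X\<close> are excluded in total, which leaves one
  \<open>x\<close> that can be fixed before \<open>y\<close> is chosen.\<close>

lemma common_repeated_point:
  assumes "finite X" and "finite Y"
    and "\<And>x y. x \<in> X \<Longrightarrow> y \<in> Y \<Longrightarrow> c y x \<in> Z y"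
    and "\<And>y. y \<in> Y \<Longrightarrow> finite (Z y)" "\<And>y. y \<in> Y \<Longrightarrow> card (Z y) \<le> q"
    and "card Y * q < card X"
  shows "\<exists>x\<in>X. \<forall>y\<in>Y. \<exists>x'\<in>X. x' \<noteq> x \<and> c y x' = c y x"
proof (rule ccontr)
  assume neg: "\<not> ?thesis"
  define U where "U y = {x \<in> X. \<forall>x'\<in>X. x' \<noteq> x \<longrightarrow> c y x' \<noteq> c y x}" for y
  have "card (U y) \<le> q" if "y \<in> Y" for y
  proof -
    have "inj_on (c y) (U y)" unfolding inj_on_def U_def by auto
    moreover have "c y ` U y \<subseteq> Z y" using assms(3) that unfolding U_def by auto
    ultimately have "card (U y) \<le> card (Z y)" using assms(4)[OF that] by (meson card_inj_on_le)
    then show ?thesis using assms(5)[OF that] by simp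
  qed
  then have "card (\<Union>y\<in>Y. U y) \<le> card Y * q"
    using card_UN_le[OF assms(2), of U] sum_bounded_above[of Y "\<lambda>y. card (U y)" q] by force
  moreover have "X \<subseteq> (\<Union>y\<in>Y. U y)" using neg unfolding U_def by fastforce
  then have "card X \<le> card (\<Union>y\<in>Y. U y)"
    using assms(1,2) by (intro card_mono) (auto simp: U_def)
  ultimately show False using assms(6) by simp
qed

lemma pigeonhole_pair:
  assumes "\<And>x. x \<in> X \<Longrightarrow> c x \<in> Z" and "finite Z" and "card Z < card X"
  shows "\<exists>x\<in>X. \<exists>x'\<in>X. x \<noteq> x' \<and> c x = c x'"
proof -
  have "card (c ` X) < card X"
    using assms card_mono[of Z "c ` X"] by (meson image_subsetI le_less_trans)
  then show ?thesis using pigeonhole[of c X] unfolding inj_on_def by blast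
qed

section \<open>Cliques\<close>

text \<open>Between complete graphs any bijection of the nodes is an isomorphism, so only the vertex
  set of a copy matters.\<close>

lemma mem_detect_complete_graph:
  "mem_detect (complete_graph s) G v \<longleftrightarrow>
     (\<exists>S. finite S \<and> S \<subseteq> verts G \<and> card S = s \<and> v \<in> S \<and>
       (\<forall>x\<in>S. \<forall>y\<in>S. x \<noteq> y \<longrightarrow> {x, y} \<in> edges G))"
proof
  assume "mem_detect (complete_graph s) G v"
  then obtain H f where H: "subgraph H G" "v \<in> verts H"
    and bij: "bij_betw f (verts H) {1..s}"
    and edge: "\<And>x y. x \<in> verts H \<Longrightarrow> y \<in> verts H \<Longrightarrow>
      {x, y} \<in> edges H \<longleftrightarrow> {f x, f y} \<in> edges (complete_graph s)"
    unfolding mem_detect_def isomorphic_def by (auto simp: complete_graph_def)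
  have "{x, y} \<in> edges G" if "x \<in> verts H" "y \<in> verts H" "x \<noteq> y" for x y
  proof -
    have "f x \<in> {1..s}" "f y \<in> {1..s}" "f x \<noteq> f y"
      using that bij unfolding bij_betw_def inj_on_def by auto
    then have "{f x, f y} \<in> edges (complete_graph s)"
      by (auto simp: complete_graph_def)
    then show ?thesis using edge[OF that(1,2)] H(1) unfolding subgraph_def by blast
  qed
  moreover have "card (verts H) = s" using bij_betw_same_card[OF bij] by simp
  ultimately show "\<exists>S. finite S \<and> S \<subseteq> verts G \<and> card S = s \<and> v \<in> S \<and>
       (\<forall>x\<in>S. \<forall>y\<in>S. x \<noteq> y \<longrightarrow> {x, y} \<in> edges G)"
    using H unfolding subgraph_def simple_graph_def by (intro exI[of _ "verts H"]) auto
next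
  assume "\<exists>S. finite S \<and> S \<subseteq> verts G \<and> card S = s \<and> v \<in> S \<and>
       (\<forall>x\<in>S. \<forall>y\<in>S. x \<noteq> y \<longrightarrow> {x, y} \<in> edges G)"
  then obtain S where S: "finite S" "S \<subseteq> verts G" "card S = s" "v \<in> S"
    and edge: "\<And>x y. x \<in> S \<Longrightarrow> y \<in> S \<Longrightarrow> x \<noteq> y \<Longrightarrow> {x, y} \<in> edges G"
    by auto
  define H where "H = \<lparr>verts = S, edges = {{x, y} | x y. x \<in> S \<and> y \<in> S \<and> x \<noteq> y}\<rparr>"
  obtain f where f: "bij_betw f S {1..s}"
    using finite_same_card_bij[of S "{1..s}"] S by auto
  \<comment> \<open>The case \<open>x = y\<close> is included: a singleton is an edge of neither
    graph.\<close>
  have "{x, y} \<in> edges H \<longleftrightarrow> {f x, f y} \<in> edges (complete_graph s)"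
    if "x \<in> S" "y \<in> S" for x y
  proof -
    have "f x \<in> {1..s}" "f y \<in> {1..s}" "f x = f y \<longleftrightarrow> x = y"
      using that f unfolding bij_betw_def inj_on_def by auto
    then show ?thesis using that
      unfolding H_def complete_graph_def by (auto simp: doubleton_eq_iff)
  qed
  then have "isomorphic H (complete_graph s)"
    using f unfolding isomorphic_def by (intro exI[of _ f]) (auto simp: H_def complete_graph_def)
  moreover have "subgraph H G"
    using S edge unfolding subgraph_def simple_graph_def by (auto simp: H_def)
  ultimately show "mem_detect (complete_graph s) G v"
    using S(4) unfolding mem_detect_def by (intro exI[of _ H]) (simp add: H_def)
qed

section \<open>Attaching nodes to cliques\<close>

text \<open>Names by role, to be mapped to identifiers by \<open>nd\<close>: \<open>Core k a\<close>
  is the \<open>a\<close>-th member of the \<open>k\<close>-th clique, \<open>Outer x\<close> a node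
  to be attached to a clique.\<close>

datatype node = Outer nat | Core nat nat

instance node :: countable by countable_datatype

text \<open>Names outside \<open>D\<close> are sent beyond \<open>n\<close>. This makes the map
  injective on the whole type, so that equations between identifiers reduce to equations between
  names without side conditions.\<close>

lemma inj_into_interval:
  fixes D :: "node set"
  assumes "finite D" and "card D \<le> n"
  shows "\<exists>nd :: node \<Rightarrow> nat. inj nd \<and> nd ` D \<subseteq> {1..n}"
proof -
  obtain h where h: "inj_on h D" "h ` D \<subseteq> {1..n}"
    using card_le_inj[of D "{1..n}"] assms by auto
  define nd where "nd x = (if x \<in> D then h x else Suc n + to_nat x)" for x
  have "inj nd"
  proof (rule injI)
    fix x y assume eq: "nd x = nd y"
    have "h z \<le> n" if "z \<in> D" for z using h(2) that by auto
    then have "x \<in> D \<longleftrightarrow> y \<in> D" using eq unfolding nd_def by (metis Suc_n_not_le_n le_add1 le_trans)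
    then show "x = y" using eq h(1) unfolding nd_def inj_on_def by (auto split: if_splits)
  qed
  moreover have "nd ` D \<subseteq> {1..n}" using h(2) by (auto simp: nd_def)
  ultimately show ?thesis by blast
qed

text \<open>There are \<open>K\<close> cliques of size \<open>r\<close>, \<open>M\<close> outer
  nodes for early attachment, \<open>W\<close> outer nodes for late attachment, and \<open>T\<close>
  periods in which the late attachment may happen.\<close>

locale core_networks =
  fixes n r K M W T :: nat and nd :: "node \<Rightarrow> nat"
  assumes inj_nd: "inj nd" and r_pos: "0 < r"
    and outer_range: "x < M + W \<Longrightarrow> nd (Outer x) \<in> {1..n}"
    and core_range: "k < K \<Longrightarrow> a < r \<Longrightarrow> nd (Core k a) \<in> {1..n}"
begin

section \<open>The networks: neighbourhoods, admissibility and maximum degree\<close>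

lemma nd_eq_iff [simp]: "nd x = nd y \<longleftrightarrow> x = y"
  using inj_nd by (auto dest: injD)

definition core :: "nat \<Rightarrow> nat set" where
  "core k = (\<lambda>a. nd (Core k a)) ` {..<r}"

text \<open>A triple \<open>(b, x, k)\<close> in \<open>f\<close> means that in the \<open>b\<close>-th block of \<open>r\<close> rounds the node \<open>Outer x\<close>
  is connected to the members of the \<open>k\<close>-th clique one by one. The edges between outer nodes that
  are given by \<open>F\<close> are inserted after the last block.\<close>

definition net :: "(nat \<times> nat \<times> nat) set \<Rightarrow> (nat \<times> nat) set \<Rightarrow> dynamic_network" where
  "net f F m =
     \<lparr>verts = {1..n},
      edges = {{nd (Core k a), nd (Core k b)} | k a b. k < K \<and> a < r \<and> b < r \<and> a \<noteq> b}
        \<union> {{nd (Outer x), nd (Core k a)} | x k a. \<exists>b. (b, x, k) \<in> f \<and> a < r \<and> b * r + a < m}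
        \<union> {{nd (Outer x), nd (Outer y)} | x y. (x, y) \<in> F \<and> (M + T) * r < m}\<rparr>"

lemma neighbours_outer:
  "neighbours (net f F m) (nd (Outer x)) =
     {nd (Core k a) | k a. \<exists>b. (b, x, k) \<in> f \<and> a < r \<and> b * r + a < m}
     \<union> {nd (Outer y) | y. ((x, y) \<in> F \<or> (y, x) \<in> F) \<and> (M + T) * r < m}"
  unfolding neighbours_def net_def by (auto simp: doubleton_eq_iff)

lemma neighbours_core:
  "neighbours (net f F m) (nd (Core k a)) =
     {nd (Core k b) | b. k < K \<and> a < r \<and> b < r \<and> a \<noteq> b}
     \<union> {nd (Outer x) | x. \<exists>b. (b, x, k) \<in> f \<and> a < r \<and> b * r + a < m}"
  unfolding neighbours_def net_def by (auto simp: doubleton_eq_iff)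

lemma neighbours_other:
  "v \<notin> range nd \<Longrightarrow> neighbours (net f F m) v = {}"
  unfolding neighbours_def net_def by (auto simp: doubleton_eq_iff)

lemma net_0: "net f F 0 = net g F' 0"
  unfolding net_def by simp

lemma verts_net: "verts (net f F m) = {1..n}"
  unfolding net_def by simp

lemma block_less: "b < c \<Longrightarrow> a < r \<Longrightarrow> b * r + a < c * r"
  by (metis Suc_leI add.commute mult_Suc mult_le_mono1 nat_add_left_cancel_less order_less_le_trans)

text \<open>A block carries at most one triple and each of its rounds treats one clique member, so a
  round adds at most one edge. The edge of \<open>F\<close> comes when all blocks are over.\<close>

lemma net_in_insertion_networks:
  assumes f: "\<And>b x k x' k'. (b, x, k) \<in> f \<Longrightarrow> (b, x', k') \<in> f \<Longrightarrow> x' = x \<and> k' = k"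
    and range: "\<And>b x k. (b, x, k) \<in> f \<Longrightarrow> b < M + T \<and> x < M + W \<and> k < K"
    and F: "F \<subseteq> {(p, q)}" "p \<noteq> q" "p < M + W" "q < M + W"
  shows "net f F \<in> insertion_networks n"
proof -
  have "simple_graph (net f F 0)"
    unfolding simple_graph_def
  proof (intro conjI ballI)
    fix e assume "e \<in> edges (net f F 0)"
    then obtain k a b where e: "e = {nd (Core k a), nd (Core k b)}" "k < K" "a < r" "b < r" "a \<noteq> b"
      unfolding net_def by auto
    show "\<exists>u\<in>verts (net f F 0). \<exists>v\<in>verts (net f F 0). u \<noteq> v \<and> e = {u, v}"
      unfolding verts_net using e core_range
      by (intro bexI[of _ "nd (Core k a)"] bexI[of _ "nd (Core k b)"]) auto
  qed (simp add: verts_net)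
  moreover have "net f F (Suc m) = net f F m \<or>
       (\<exists>u \<in> {1..n}. \<exists>v \<in> {1..n}. u \<noteq> v \<and> {u, v} \<notin> edges (net f F m) \<and>
          net f F (Suc m) = insert_edge u v (net f F m))" for m
  proof -
    have step: ?thesis
      if "edges (net f F (Suc m)) = insert {u, v} (edges (net f F m))"
        "u \<in> {1..n}" "v \<in> {1..n}" "u \<noteq> v" for u v
    proof (cases "{u, v} \<in> edges (net f F m)")
      case True
      then have "edges (net f F (Suc m)) = edges (net f F m)" using that(1) by auto
      then have "net f F (Suc m) = net f F m" by (simp add: net_def)
      then show ?thesis ..
    next
      case False
      then have "net f F (Suc m) = insert_edge u v (net f F m)"
        using that(1) by (simp add: insert_edge_def net_def)
      then show ?thesis using that False by blast
    qed
    \<comment> \<open>By division with remainder, round \<open>Suc m\<close> treats member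
      \<open>m mod r\<close> in block \<open>m div r\<close>.\<close>
    have new: "b * r + a < Suc m \<longleftrightarrow> b * r + a < m \<or> b = m div r \<and> a = m mod r"
      if "a < r" for a b
      using that r_pos by (auto simp: less_Suc_eq div_mult_mod_eq)
    show ?thesis
    proof (cases "m = (M + T) * r \<and> F \<noteq> {}")
      case True
      then have "F = {(p, q)}" using F by auto
      moreover have "b * r + a < m" if "(b, x, k) \<in> f" "a < r" for a b x k
        using block_less range that True by blast
      then have "(\<exists>b. (b, x, k) \<in> f \<and> a < r \<and> b * r + a < Suc m) \<longleftrightarrow>
         (\<exists>b. (b, x, k) \<in> f \<and> a < r \<and> b * r + a < m)" for a x k
        using less_SucI by blast
      ultimately have "edges (net f F (Suc m)) = insert {nd (Outer p), nd (Outer q)} (edges (net f F m))"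
        using True unfolding net_def by auto
      then show ?thesis using step F outer_range by simp
    next
      case last: False
      then have F_eq: "{{nd (Outer x), nd (Outer y)} | x y. (x, y) \<in> F \<and> (M + T) * r < Suc m} =
          {{nd (Outer x), nd (Outer y)} | x y. (x, y) \<in> F \<and> (M + T) * r < m}"
        by (auto simp: less_Suc_eq)
      show ?thesis
      proof (cases "\<exists>x k. (m div r, x, k) \<in> f")
        case True
        then obtain x k where xk: "(m div r, x, k) \<in> f" by blast
        have "(\<exists>b. (b, x', k') \<in> f \<and> a < r \<and> b * r + a < Suc m) \<longleftrightarrow>
            (\<exists>b. (b, x', k') \<in> f \<and> a < r \<and> b * r + a < m) \<or> x' = x \<and> k' = k \<and> a = m mod r" for a x' k'
        proof (cases "a < r")
          case True
          have "(m div r, x', k') \<in> f \<longleftrightarrow> x' = x \<and> k' = k" using f[OF xk, of x' k'] xk by auto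
          then show ?thesis unfolding new[OF True] using True by auto
        next
          case False
          then show ?thesis using r_pos by auto
        qed
        note attached = this
        have "{{nd (Outer x'), nd (Core k' a)} | x' k' a. \<exists>b. (b, x', k') \<in> f \<and> a < r \<and> b * r + a < Suc m} =
            insert {nd (Outer x), nd (Core k (m mod r))}
              {{nd (Outer x'), nd (Core k' a)} | x' k' a. \<exists>b. (b, x', k') \<in> f \<and> a < r \<and> b * r + a < m}"
          unfolding attached by blast
        then have "edges (net f F (Suc m)) =
            insert {nd (Outer x), nd (Core k (m mod r))} (edges (net f F m))"
          unfolding net_def graph.simps F_eq by simp
        moreover have "nd (Outer x) \<in> {1..n}" "nd (Core k (m mod r)) \<in> {1..n}"
          using range[OF xk] outer_range[of x] core_range[of k "m mod r"] r_pos by simp_all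
        ultimately show ?thesis by (rule step) simp
      next
        case False
        then have "(\<exists>b. (b, x, k) \<in> f \<and> a < r \<and> b * r + a < Suc m) \<longleftrightarrow>
            (\<exists>b. (b, x, k) \<in> f \<and> a < r \<and> b * r + a < m)" for a x k
          using new by metis
        then show ?thesis unfolding net_def F_eq by simp
      qed
    qed
  qed
  ultimately show ?thesis unfolding insertion_networks_def by (simp add: verts_net)
qed

lemma card_core: "card (core k) = r"
  unfolding core_def by (subst card_image) (auto simp: inj_on_def)

lemma outer_notin_core: "nd (Outer x) \<notin> core k"
  unfolding core_def by auto

lemma finite_core: "finite (core k)"
  unfolding core_def by simp

text \<open>An outer node is attached to at most one clique, a clique gets at most two outer nodes,
  and \<open>F\<close> adds at most one edge. Hence the bound depends on \<open>r\<close> alone, not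
  on the number of nodes or periods.\<close>

lemma max_degree_net:
  assumes outer: "\<And>b x k b' k'. (b, x, k) \<in> f \<Longrightarrow> (b', x, k') \<in> f \<Longrightarrow> k' = k"
    and core: "\<And>k. \<exists>y z. \<forall>b x. (b, x, k) \<in> f \<longrightarrow> x = y \<or> x = z"
    and F: "F \<subseteq> {(p, q)}"
  shows "max_degree_le (r + 2) (net f F)"
  unfolding max_degree_le_def
proof (intro allI ballI)
  fix m v
  consider x where "v = nd (Outer x)" | k a where "v = nd (Core k a)" | "v \<notin> range nd"
    by (metis node.exhaust rangeE)
  then show "card (neighbours (net f F m) v) \<le> r + 2"
  proof cases
    case (1 x)
    obtain k where k: "\<And>b k'. (b, x, k') \<in> f \<Longrightarrow> k' = k" using outer by metis
    have "neighbours (net f F m) v \<subseteq> core k \<union> {nd (Outer p), nd (Outer q)}"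
      using F k unfolding 1 neighbours_outer core_def by auto
    then have "card (neighbours (net f F m) v) \<le> card (core k \<union> {nd (Outer p), nd (Outer q)})"
      by (intro card_mono) (auto simp: finite_core)
    also have "\<dots> \<le> card (core k) + card {nd (Outer p), nd (Outer q)}" by (rule card_Un_le)
    also have "\<dots> \<le> r + 2" by (simp add: card_core card_insert_if)
    finally show ?thesis .
  next
    case (2 k a)
    obtain y z where yz: "\<And>b x. (b, x, k) \<in> f \<Longrightarrow> x = y \<or> x = z" using core by metis
    have "neighbours (net f F m) v \<subseteq> core k \<union> {nd (Outer y), nd (Outer z)}"
      using yz unfolding 2 neighbours_core core_def by auto
    then have "card (neighbours (net f F m) v) \<le> card (core k \<union> {nd (Outer y), nd (Outer z)})"
      by (intro card_mono) (auto simp: finite_core)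
    also have "\<dots> \<le> card (core k) + card {nd (Outer y), nd (Outer z)}" by (rule card_Un_le)
    also have "\<dots> \<le> r + 2" by (simp add: card_core card_insert_if)
    finally show ?thesis .
  next
    case 3
    then show ?thesis by (simp add: neighbours_other)
  qed
qed

section \<open>Single components and indistinguishable networks\<close>

lemma net_early: "m \<le> (M + T) * r \<Longrightarrow> net f F m = net f F' m"
  unfolding net_def by simp

text \<open>\<open>Outer i\<close> with \<open>i < M\<close> is attached in block \<open>i\<close>, a different one for each \<open>i\<close>, whereas any
  \<open>Outer (M + l)\<close> may be attached in any of the last \<open>T\<close> blocks.\<close>

definition sched :: "nat \<Rightarrow> nat \<Rightarrow> nat \<Rightarrow> nat \<Rightarrow> (nat \<times> nat \<times> nat) set" where
  "sched i k t l = {(i, i, k), (M + t, M + l, k)}"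

text \<open>One component alone, without the edge between its two outer nodes: whatever one of them
  learns about the other passes through the clique.\<close>

abbreviation path :: "nat \<Rightarrow> nat \<Rightarrow> nat \<Rightarrow> nat \<Rightarrow> dynamic_network" where
  "path i k t l \<equiv> net (sched i k t l) {}"

lemma neighbours_path_late:
  "i < M \<Longrightarrow> neighbours (path i k t l m) (nd (Outer (M + l))) =
     {nd (Core k a) | a. a < r \<and> (M + t) * r + a < m}"
  unfolding neighbours_outer sched_def by auto

lemma neighbours_path_early:
  "i < M \<Longrightarrow> neighbours (path i k t l m) (nd (Outer i)) =
     {nd (Core k a) | a. a < r \<and> i * r + a < m}"
  unfolding neighbours_outer sched_def by auto

definition component :: "nat \<Rightarrow> nat \<Rightarrow> nat \<Rightarrow> nat set" where
  "component i k l = insert (nd (Outer i)) (insert (nd (Outer (M + l))) (core k))"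

text \<open>Up to round \<open>(M + T) * r\<close> the component is closed under neighbours, since
  \<open>g\<close> avoids its nodes and the edge of \<open>F\<close> is still missing. So it runs as
  if it were alone.\<close>

lemma history_component:
  assumes g: "\<And>b x k'. (b, x, k') \<in> g \<Longrightarrow> x \<noteq> i \<and> x \<noteq> M + l \<and> k' \<noteq> k"
    and "v \<in> component i k l" and "m \<le> (M + T) * r"
  shows "history A (net (sched i k t l \<union> g) F) m v = history A (path i k t l) m v"
proof (rule history_local[where C = "component i k l"])
  fix q v
  assume q: "Suc q \<le> m" and v: "v \<in> component i k l"
  have early: "net (sched i k t l \<union> g) F (Suc q) = net (sched i k t l \<union> g) {} (Suc q)"
    using q assms(3) by (intro net_early) simp
  from v consider x where "v = nd (Outer x)" "x = i \<or> x = M + l" | a where "v = nd (Core k a)" "a < r"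
    unfolding component_def core_def by auto
  then have "neighbours (net (sched i k t l \<union> g) F (Suc q)) v = neighbours (path i k t l (Suc q)) v \<and>
      neighbours (net (sched i k t l \<union> g) F (Suc q)) v \<subseteq> component i k l"
  proof cases
    case 1
    then have "(b, x, k') \<notin> g" for b k' using g by blast
    then show ?thesis using 1
      unfolding early unfolding 1(1) neighbours_outer component_def core_def sched_def by auto
  next
    case 2
    have "(b, x, k) \<notin> g" for b x using g by blast
    then show ?thesis using 2
      unfolding early unfolding 2(1) neighbours_core component_def core_def sched_def by auto
  qed
  then show "neighbours (net (sched i k t l \<union> g) F (Suc q)) v = neighbours (path i k t l (Suc q)) v"
    and "neighbours (net (sched i k t l \<union> g) F (Suc q)) v \<subseteq> component i k l"
    by auto
qed (use assms(2) net_0 in auto)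

lemma finished_blocks:
  assumes "b < M + T"
  shows "{nd (Core k a) | a. a < r \<and> b * r + a < Suc ((M + T) * r)} = core k"
  using block_less[OF assms] less_SucI unfolding core_def by blast

text \<open>Before the last round \<open>w\<close> hears only from its own component, in which
  \<open>late\<close> exchanges \<open>j\<close> and \<open>i\<close>. In the last round its
  neighbour list is the same in both networks, the clique members are not affected by the new edge,
  and \<open>last_msg\<close> takes care of the message of \<open>Outer i\<close>.\<close>

lemma history_eq_indistinguishable:
  fixes A :: algorithm
  assumes i: "i < M" and j: "j < M" "j \<noteq> i" and "k' \<noteq> k" and t: "t < T" "t' < T" and "l' \<noteq> l"
  defines "R \<equiv> (M + T) * r" and "w \<equiv> nd (Outer (M + l))"
  assumes late: "history A (path j k t l) (Suc R) w = history A (path i k t l) (Suc R) w"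
    and last_msg: "send_msg A (nd (Outer i)) (net {} {} 0)
        (history A (path i k' t' l') R (nd (Outer i))) (insert w (core k')) w =
      send_msg A (nd (Outer i)) (net {} {} 0)
        (history A (path i k t l) R (nd (Outer i))) (insert w (core k)) w"
  shows "history A (net (sched i k' t' l' \<union> sched j k t l) {(i, M + l)}) (Suc R) w =
    history A (net (sched i k t l) {(i, M + l)}) (Suc R) w"
proof -
  define G where "G = net (sched i k t l) {(i, M + l)}"
  define H where "H = net (sched i k' t' l' \<union> sched j k t l) {(i, M + l)}"
  have G0: "G 0 = net {} {} 0" "H 0 = net {} {} 0" "path i k t l 0 = net {} {} 0"
    "path j k t l 0 = net {} {} 0"
    unfolding G_def H_def by (rule net_0)+
  have hG: "history A G R v = history A (path i k t l) R v" if "v \<in> component i k l" for v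
    using history_component[of "{}" i l k v R A t "{(i, M + l)}"] that
    unfolding G_def R_def by simp
  have hH: "history A H R v = history A (path j k t l) R v" if "v \<in> component j k l" for v
    unfolding H_def R_def Un_commute[of "sched i k' t' l'"]
    by (rule history_component) (use that assms(1-7) in \<open>auto simp: sched_def\<close>)
  have hH': "history A H R v = history A (path i k' t' l') R v" if "v \<in> component i k' l'" for v
    unfolding H_def R_def
    by (rule history_component) (use that assms(1-7) in \<open>auto simp: sched_def\<close>)
  have early: "{nd (Core k a) | a. a < r \<and> i * r + a < Suc R} = core k" for k
    unfolding R_def using i by (intro finished_blocks) simp
  have nbG: "neighbours (G (Suc R)) w = insert (nd (Outer i)) (core k)"
    "neighbours (G (Suc R)) (nd (Outer i)) = insert w (core k)"
    using finished_blocks[of "M + t" k] early[of k] i t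
    unfolding G_def w_def neighbours_outer sched_def by (auto simp: R_def)
  have nbH: "neighbours (H (Suc R)) w = insert (nd (Outer i)) (core k)"
    "neighbours (H (Suc R)) (nd (Outer i)) = insert w (core k')"
    using finished_blocks[of "M + t" k] early[of k'] assms(1-7)
    unfolding H_def w_def neighbours_outer sched_def by (auto simp: R_def)
  have nbP: "neighbours (path i k t l (Suc R)) w = core k" "neighbours (path j k t l (Suc R)) w = core k"
    using finished_blocks[of "M + t" k] neighbours_path_late i j t
    unfolding w_def R_def by auto
  \<comment> \<open>\<open>late\<close> covers one round beyond \<open>R\<close>, hence also what
    the clique members send in the round of the last edge.\<close>
  have late': "history A (path j k t l) R w = history A (path i k t l) R w"
    "recv A (path j k t l) R w = recv A (path i k t l) R w"
    using late unfolding history_Suc by auto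
  have wC: "w \<in> component i k l" "w \<in> component j k l" unfolding component_def w_def by auto
  have uC: "nd (Outer i) \<in> component i k l" "nd (Outer i) \<in> component i k' l'"
    unfolding component_def by auto
  have "recv A H R w v = recv A G R w v" for v
  proof -
    consider "v = nd (Outer i)" | "v \<in> core k" | "v \<notin> insert (nd (Outer i)) (core k)" by blast
    then show ?thesis
    proof cases
      case 1
      then show ?thesis using last_msg
        by (simp add: recv_def nbG nbH G0 hG[OF uC(1)] hH'[OF uC(2)])
    next
      case 2
      then obtain a where a: "v = nd (Core k a)" "a < r" unfolding core_def by auto
      have vC: "v \<in> component i k l" "v \<in> component j k l" using 2 unfolding component_def by auto
      \<comment> \<open>The last edge joins two outer nodes, so the clique members send what they
        send on the path without it.\<close>
      have "neighbours (G (Suc R)) v = neighbours (path i k t l (Suc R)) v"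
        unfolding G_def a neighbours_core by simp
      then have "recv A G R w v = recv A (path i k t l) R w v"
        using 2 by (simp add: recv_def nbG nbP G0 hG[OF vC(1)])
      moreover have "neighbours (H (Suc R)) v = neighbours (path j k t l (Suc R)) v"
        using assms(1-7) unfolding H_def a neighbours_core sched_def by auto
      then have "recv A H R w v = recv A (path j k t l) R w v"
        using 2 by (simp add: recv_def nbH nbP G0 hH[OF vC(2)])
      ultimately show ?thesis using late'(2) by simp
    next
      case 3
      then show ?thesis by (simp add: recv_def nbG nbH)
    qed
  qed
  then have "recv A H R w = recv A G R w" by blast
  then have "history A H (Suc R) w = history A G (Suc R) w"
    unfolding history_Suc nbG nbH hG[OF wC(1)] hH[OF wC(2)] late'(1) by simp
  then show ?thesis unfolding G_def H_def .
qed

section \<open>Counting the possible traces of messages from a clique\<close>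

text \<open>Only the rounds from \<open>M * r\<close> on are recorded: before them, the late node has no neighbours and
  the execution does not depend on which late node will be attached.\<close>

definition trace :: "algorithm \<Rightarrow> nat \<Rightarrow> nat set \<Rightarrow> dynamic_network \<Rightarrow> nat \<times> nat \<Rightarrow> message" where
  "trace A v S G = restrict (\<lambda>(q, u). recv A G q v u) ({M * r..(M + T) * r} \<times> S)"

lemma trace_in_PiE:
  "has_bandwidth B A \<Longrightarrow> trace A v S G \<in> {M * r..(M + T) * r} \<times> S \<rightarrow>\<^sub>E messages B"
  unfolding trace_def using recv_in_messages by auto

text \<open>The exponent counts \<open>T * r + 1\<close> rounds, the last one being that of the
  final edge, for each of \<open>r\<close> senders.\<close>

lemma card_traces:
  "card ({M * r..(M + T) * r} \<times> core k \<rightarrow>\<^sub>E messages B) = 2 ^ (Suc B * ((T * r + 1) * r))"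
proof -
  have "Suc ((M + T) * r) - M * r = T * r + 1" by (simp add: algebra_simps)
  then show ?thesis
    by (simp only: card_funcsetE finite_cartesian_product finite_core finite_atLeastAtMost
        card_cartesian_product card_atLeastAtMost card_core card_messages power_mult)
qed

lemma finite_traces: "finite ({M * r..(M + T) * r} \<times> core k \<rightarrow>\<^sub>E messages B)"
  by (intro finite_PiE) (auto simp: finite_core finite_messages)

lemma recv_eq_if_trace_eq:
  assumes "trace A v S G = trace A v S H" "u \<in> S" "M * r \<le> q" "q < Suc ((M + T) * r)"
  shows "recv A G q v u = recv A H q v u"
  using fun_cong[OF assms(1), of "(q, u)"] assms(2-4) unfolding trace_def by simp

text \<open>For each \<open>(k, t, l)\<close> the early nodes are coloured by the trace of the late
  node. The neighbour lists of the late node do not depend on the early node, so equal traces give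
  equal histories. One \<open>i\<close> must serve for all late nodes, whence the factor
  \<open>W\<close>.\<close>

lemma exists_early_node:
  assumes bw: "has_bandwidth B A"
    and M: "K * T * W * 2 ^ (Suc B * ((T * r + 1) * r)) < M"
  shows "\<exists>i<M. \<forall>k<K. \<forall>t<T. \<forall>l<W. \<exists>j<M. j \<noteq> i \<and>
    history A (path j k t l) (Suc ((M + T) * r)) (nd (Outer (M + l))) =
    history A (path i k t l) (Suc ((M + T) * r)) (nd (Outer (M + l)))"
proof -
  define c where "c = (\<lambda>(k, t, l) i. trace A (nd (Outer (M + l))) (core k) (path i k t l))"
  define Z where "Z = (\<lambda>(k, t :: nat, l :: nat). {M * r..(M + T) * r} \<times> core k \<rightarrow>\<^sub>E messages B)"
  have "\<exists>i\<in>{..<M}. \<forall>y\<in>{..<K} \<times> {..<T} \<times> {..<W}. \<exists>j\<in>{..<M}. j \<noteq> i \<and> c y j = c y i"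
    by (rule common_repeated_point[where Z = Z and q = "2 ^ (Suc B * ((T * r + 1) * r))"])
      (use M in \<open>simp_all add: c_def Z_def case_prod_beta trace_in_PiE[OF bw] card_traces
        finite_traces mult.assoc del: mult_Suc power_Suc\<close>)
  then obtain i where i: "i < M" and
    rep: "\<And>k t l. k < K \<Longrightarrow> t < T \<Longrightarrow> l < W \<Longrightarrow> \<exists>j<M. j \<noteq> i \<and> c (k, t, l) j = c (k, t, l) i"
    by fastforce
  have "history A (path j k t l) (Suc ((M + T) * r)) (nd (Outer (M + l))) =
      history A (path i k t l) (Suc ((M + T) * r)) (nd (Outer (M + l)))"
    if "c (k, t, l) j = c (k, t, l) i" "j < M" for j k t l
  proof (rule history_eqI[where m\<^sub>0 = "M * r" and S = "core k"])
    have none: "neighbours (path i' k t l (Suc q)) (nd (Outer (M + l))) = {}"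
      if "Suc q \<le> M * r" "i' < M" for i' q
      using that by (auto simp: neighbours_path_late algebra_simps)
    show "history A (path j k t l) (M * r) (nd (Outer (M + l))) =
        history A (path i k t l) (M * r) (nd (Outer (M + l)))"
      by (rule history_local[where C = "{nd (Outer (M + l))}"])
        (use net_0 none i \<open>j < M\<close> in auto)
  next
    fix q u assume "M * r \<le> q" "q < Suc ((M + T) * r)" "u \<in> core k"
    then show "recv A (path j k t l) q (nd (Outer (M + l))) u =
        recv A (path i k t l) q (nd (Outer (M + l))) u"
      using that(1) unfolding c_def by (auto intro: recv_eq_if_trace_eq)
  qed (use i that in \<open>auto simp: neighbours_path_late core_def algebra_simps\<close>)
  then show ?thesis using i rep by meson
qed

text \<open>Now the late nodes are coloured by what \<open>Outer i\<close> receives. As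
  \<open>i\<close> is already fixed, the bound on \<open>W\<close> is free of \<open>M\<close>, and
  the two bounds are not circular.\<close>

lemma exists_late_node:
  assumes bw: "has_bandwidth B A" and i: "i < M"
    and W: "K * T * 2 ^ (Suc B * ((T * r + 1) * r)) < W"
  shows "\<exists>l<W. \<forall>k<K. \<forall>t<T. \<exists>l'<W. l' \<noteq> l \<and>
    history A (path i k t l') (Suc ((M + T) * r)) (nd (Outer i)) =
    history A (path i k t l) (Suc ((M + T) * r)) (nd (Outer i))"
proof -
  define c where "c = (\<lambda>(k, t) l. trace A (nd (Outer i)) (core k) (path i k t l))"
  define Z where "Z = (\<lambda>(k, t :: nat). {M * r..(M + T) * r} \<times> core k \<rightarrow>\<^sub>E messages B)"
  have "\<exists>l\<in>{..<W}. \<forall>y\<in>{..<K} \<times> {..<T}. \<exists>l'\<in>{..<W}. l' \<noteq> l \<and> c y l' = c y l"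
    by (rule common_repeated_point[where Z = Z and q = "2 ^ (Suc B * ((T * r + 1) * r))"])
      (use W in \<open>simp_all add: c_def Z_def case_prod_beta trace_in_PiE[OF bw] card_traces
        finite_traces mult.assoc del: mult_Suc power_Suc\<close>)
  then obtain l where l: "l < W" and
    rep: "\<And>k t. k < K \<Longrightarrow> t < T \<Longrightarrow> \<exists>l'<W. l' \<noteq> l \<and> c (k, t) l' = c (k, t) l"
    by fastforce
  have "history A (path i k t l') (Suc ((M + T) * r)) (nd (Outer i)) =
      history A (path i k t l) (Suc ((M + T) * r)) (nd (Outer i))"
    if "c (k, t) l' = c (k, t) l" for l' k t
  proof (rule history_eqI[where m\<^sub>0 = "M * r" and S = "core k"])
    \<comment> \<open>The two runs differ only from block \<open>M\<close> on. Recording can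
      therefore start there, which keeps the number of traces independent of
      \<open>M\<close>.\<close>
    have same: "path i k t l' q = path i k t l q" if "q \<le> M * r" for q
    proof -
      have "\<not> (M + t) * r + a < q" for a using that by (simp add: algebra_simps)
      then have "(\<exists>b. (b, x, k') \<in> sched i k t l' \<and> a < r \<and> b * r + a < q) \<longleftrightarrow>
          (\<exists>b. (b, x, k') \<in> sched i k t l \<and> a < r \<and> b * r + a < q)" for x k' a
        unfolding sched_def by auto
      then show ?thesis unfolding net_def by simp
    qed
    show "history A (path i k t l') (M * r) (nd (Outer i)) = history A (path i k t l) (M * r) (nd (Outer i))"
      by (rule history_local[where C = UNIV]) (use net_0 same in auto)
  next
    fix q u assume "M * r \<le> q" "q < Suc ((M + T) * r)" "u \<in> core k"
    then show "recv A (path i k t l') q (nd (Outer i)) u = recv A (path i k t l) q (nd (Outer i)) u"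
      using that(1) unfolding c_def by (auto intro: recv_eq_if_trace_eq)
  qed (use i in \<open>auto simp: neighbours_path_early core_def algebra_simps\<close>)
  then show ?thesis using l rep by meson
qed

text \<open>The order of choices matters. First \<open>i\<close> is fixed, then \<open>l\<close>,
  both good for all cliques and periods; then \<open>k\<close>, \<open>k'\<close>, \<open>t\<close>,
  \<open>t'\<close> are picked by comparing last messages, and finally \<open>j\<close> and
  \<open>l'\<close> as doubles of \<open>i\<close> and \<open>l\<close>.\<close>

lemma not_one_round_solves:
  assumes bw: "has_bandwidth B A"
    and T: "2 ^ Suc B < T" and K: "2 ^ (Suc B * T) < K"
    and W: "K * T * 2 ^ (Suc B * ((T * r + 1) * r)) < W"
    and M: "K * T * W * 2 ^ (Suc B * ((T * r + 1) * r)) < M"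
  shows "\<not> one_round_solves A (mem_detect (complete_graph (r + 2)))
    {G \<in> insertion_networks n. max_degree_le (r + 2) G}"
proof
  assume solves: "one_round_solves A (mem_detect (complete_graph (r + 2)))
    {G \<in> insertion_networks n. max_degree_le (r + 2) G}"
  then have correct: "node_output A v (N 0) (history A N m v) \<longleftrightarrow> mem_detect (complete_graph (r + 2)) (N m) v"
    if "N \<in> insertion_networks n" "max_degree_le (r + 2) N" "1 \<le> m" "v \<in> verts (N m)" for N m v
    using that unfolding one_round_solves_def by blast
  let ?R = "(M + T) * r"
  obtain i where i: "i < M" and early: "\<And>k t l. k < K \<Longrightarrow> t < T \<Longrightarrow> l < W \<Longrightarrow> \<exists>j<M. j \<noteq> i \<and>
      history A (path j k t l) (Suc ?R) (nd (Outer (M + l))) =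
      history A (path i k t l) (Suc ?R) (nd (Outer (M + l)))"
    using exists_early_node[OF bw M] by blast
  obtain l where l: "l < W" and late: "\<And>k t. k < K \<Longrightarrow> t < T \<Longrightarrow> \<exists>l'<W. l' \<noteq> l \<and>
      history A (path i k t l') (Suc ?R) (nd (Outer i)) =
      history A (path i k t l) (Suc ?R) (nd (Outer i))"
    using exists_late_node[OF bw i W] by blast
  define w where "w = nd (Outer (M + l))"
  define msg where "msg k t = send_msg A (nd (Outer i)) (net {} {} 0)
    (history A (path i k t l) ?R (nd (Outer i))) (insert w (core k)) w" for k t
  have msg: "msg k t \<in> messages B" for k t
    using bw unfolding msg_def has_bandwidth_def messages_def
    by (cases "send_msg A (nd (Outer i)) (net {} {} 0)
      (history A (path i k t l) ?R (nd (Outer i))) (insert w (core k)) w") auto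
  \<comment> \<open>Two cliques are found whose last messages agree as functions of the period;
    there are at most \<open>2 ^ (Suc B * T)\<close> such functions.\<close>
  have "\<exists>k\<in>{..<K}. \<exists>k'\<in>{..<K}. k \<noteq> k' \<and> restrict (msg k) {..<T} = restrict (msg k') {..<T}"
    by (rule pigeonhole_pair[where Z = "{..<T} \<rightarrow>\<^sub>E messages B"])
      (use msg K in \<open>auto simp: finite_messages finite_PiE card_funcsetE card_messages
        simp flip: power_mult simp del: mult_Suc power_Suc\<close>)
  then obtain k k' where k: "k < K" "k' < K" "k \<noteq> k'"
    and kk': "restrict (msg k) {..<T} = restrict (msg k') {..<T}" by auto
  \<comment> \<open>\<open>T\<close> exceeds the number of messages, so the last message cannot
    encode the period.\<close>
  have "\<exists>t\<in>{..<T}. \<exists>t'\<in>{..<T}. t \<noteq> t' \<and> msg k t = msg k t'"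
    by (rule pigeonhole_pair[where Z = "messages B"])
      (use msg T in \<open>auto simp: finite_messages card_messages\<close>)
  then obtain t t' where t: "t < T" "t' < T" "t \<noteq> t'" and tt': "msg k t = msg k t'" by auto
  have msg_eq: "msg k' t' = msg k t"
    using tt' fun_cong[OF kk', of t'] t by simp
  obtain j where j: "j < M" "j \<noteq> i" and hj: "history A (path j k t l) (Suc ?R) w =
      history A (path i k t l) (Suc ?R) w"
    using early k(1) t(1) l unfolding w_def by blast
  obtain l' where l': "l' < W" "l' \<noteq> l" and hl': "history A (path i k' t' l') (Suc ?R) (nd (Outer i)) =
      history A (path i k' t' l) (Suc ?R) (nd (Outer i))"
    using late k(2) t(2) by blast
  have "history A (path i k' t' l') ?R (nd (Outer i)) = history A (path i k' t' l) ?R (nd (Outer i))"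
    using hl' unfolding history_Suc by simp
  then have last_msg: "send_msg A (nd (Outer i)) (net {} {} 0)
        (history A (path i k' t' l') ?R (nd (Outer i))) (insert w (core k')) w =
      send_msg A (nd (Outer i)) (net {} {} 0)
        (history A (path i k t l) ?R (nd (Outer i))) (insert w (core k)) w"
    using msg_eq unfolding msg_def by simp
  define G where "G = net (sched i k t l) {(i, M + l)}"
  define H where "H = net (sched i k' t' l' \<union> sched j k t l) {(i, M + l)}"
  have hist: "history A H (Suc ?R) w = history A G (Suc ?R) w"
    using history_eq_indistinguishable[OF i j k(3)[symmetric] t(1,2) l'(2) hj[unfolded w_def]
      last_msg[unfolded w_def]]
    unfolding G_def H_def w_def .
  have w: "w \<in> {1..n}" using outer_range[of "M + l"] l unfolding w_def by simp
  have "G \<in> insertion_networks n"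
    unfolding G_def
    by (rule net_in_insertion_networks[OF _ _ subset_refl]) (use i l k t in \<open>auto simp: sched_def\<close>)
  moreover have "max_degree_le (r + 2) G"
    unfolding G_def
    by (rule max_degree_net[OF _ _ subset_refl]) (use i in \<open>auto simp: sched_def\<close>)
  ultimately have G: "node_output A w (G 0) (history A G (Suc ?R) w) \<longleftrightarrow>
      mem_detect (complete_graph (r + 2)) (G (Suc ?R)) w"
    by (rule correct) (use w in \<open>simp_all add: G_def verts_net\<close>)
  \<comment> \<open>Both cliques of \<open>H\<close> receive two outer nodes, and a round admits
    only one insertion. So the blocks must be distinct, which is where \<open>j \<noteq> i\<close>
    and \<open>t \<noteq> t'\<close> enter.\<close>
  have "H \<in> insertion_networks n"
    unfolding H_def
    by (rule net_in_insertion_networks[OF _ _ subset_refl]) (use i j l l' k t in \<open>auto simp: sched_def\<close>)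
  moreover have "max_degree_le (r + 2) H"
    unfolding H_def
  proof (rule max_degree_net[OF _ _ subset_refl])
    fix k0
    show "\<exists>y z. \<forall>b x. (b, x, k0) \<in> sched i k' t' l' \<union> sched j k t l \<longrightarrow> x = y \<or> x = z"
      using k(3) by (cases "k0 = k") (auto simp: sched_def)
  qed (use i j l' in \<open>auto simp: sched_def\<close>)
  ultimately have H: "node_output A w (H 0) (history A H (Suc ?R) w) \<longleftrightarrow>
      mem_detect (complete_graph (r + 2)) (H (Suc ?R)) w"
    by (rule correct) (use w in \<open>simp_all add: H_def verts_net\<close>)
  have early_all: "i * r + a < Suc ?R" "(M + t) * r + a < Suc ?R" if "a < r" for a
    using block_less[of i "M + T" a] block_less[of "M + t" "M + T" a] i t that by auto
  have "mem_detect (complete_graph (r + 2)) (G (Suc ?R)) w"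
    unfolding mem_detect_complete_graph
  proof (intro exI[of _ "component i k l"] conjI)
    show "card (component i k l) = r + 2"
      using i outer_notin_core unfolding component_def by (simp add: card_insert_if finite_core card_core)
    show "component i k l \<subseteq> verts (G (Suc ?R))"
      using outer_range[of i] outer_range[of "M + l"] core_range[of k] i l k(1)
      unfolding component_def core_def G_def verts_net by auto
    have core_edge: "{nd (Core k a), nd (Core k b)} \<in> edges (G (Suc ?R))"
      if "a < r" "b < r" "a \<noteq> b" for a b
      using that k(1) unfolding G_def net_def by auto
    have outer_edge: "{nd (Outer x), nd (Core k a)} \<in> edges (G (Suc ?R))"
      if "x = i \<or> x = M + l" "a < r" for x a
    proof -
      have "\<exists>b. (b, x, k) \<in> sched i k t l \<and> a < r \<and> b * r + a < Suc ?R"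
        using that early_all unfolding sched_def by blast
      then show ?thesis unfolding G_def net_def graph.simps by blast
    qed
    have last_edge: "{nd (Outer i), nd (Outer (M + l))} \<in> edges (G (Suc ?R))"
      unfolding G_def net_def by auto
    show "\<forall>x\<in>component i k l. \<forall>y\<in>component i k l. x \<noteq> y \<longrightarrow> {x, y} \<in> edges (G (Suc ?R))"
      using core_edge outer_edge outer_edge[unfolded insert_commute[of _ "nd (Core k _)"]]
        last_edge last_edge[unfolded insert_commute[of "nd (Outer i)"]]
      unfolding component_def core_def by auto
  qed (auto simp: component_def finite_core w_def)
  \<comment> \<open>In \<open>H\<close>, \<open>Outer i\<close> is attached to clique
    \<open>k'\<close> instead of \<open>k\<close>. A clique through \<open>w\<close> thus misses
    \<open>Outer i\<close> or all of \<open>core k\<close>, and has at most \<open>r + 1\<close>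
    nodes.\<close>
  moreover have "\<not> mem_detect (complete_graph (r + 2)) (H (Suc ?R)) w"
  proof
    assume "mem_detect (complete_graph (r + 2)) (H (Suc ?R)) w"
    then obtain S where S: "finite S" "card S = r + 2" "w \<in> S"
      and edge: "\<And>x y. x \<in> S \<Longrightarrow> y \<in> S \<Longrightarrow> x \<noteq> y \<Longrightarrow> x \<in> neighbours (H (Suc ?R)) y"
      unfolding mem_detect_complete_graph neighbours_def by blast
    have "neighbours (H (Suc ?R)) w \<subseteq> insert (nd (Outer i)) (core k)"
      using i j l'(2) unfolding w_def H_def neighbours_outer sched_def core_def by auto
    then have sub: "S \<subseteq> insert w (insert (nd (Outer i)) (core k))"
      using edge[OF _ S(3)] by blast
    have "neighbours (H (Suc ?R)) (nd (Outer i)) \<inter> core k = {}"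
      using i j k(3) unfolding H_def neighbours_outer sched_def core_def by auto
    then have "nd (Outer i) \<notin> S \<or> S \<inter> core k = {}"
      using edge[of _ "nd (Outer i)"] outer_notin_core[of i k] by blast
    then have "S \<subseteq> insert w (core k) \<or> S \<subseteq> {w, nd (Outer i)}"
      using sub by blast
    then have "card S \<le> max (card (insert w (core k))) (card {w, nd (Outer i)})"
      using card_mono[of "insert w (core k)" S] card_mono[of "{w, nd (Outer i)}" S] finite_core by auto
    also have "\<dots> \<le> r + 1"
      using r_pos by (auto simp: card_insert_if finite_core card_core)
    finally show False using S(2) by simp
  qed
  moreover have "G 0 = H 0" unfolding G_def H_def by (rule net_0)
  ultimately show False using G H unfolding hist by simp
qed

end

section \<open>The lower bound\<close>

text \<open>All parameters are bounded by powers of \<open>E = 2 ^ e\<close>, where \<open>e\<close>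
  is of order \<open>4 ^ B * r\<^sup>2\<close>; at most \<open>E ^ 12\<close> nodes suffice.\<close>

lemma not_one_round_solves_large_n:
  fixes B r n :: nat
  assumes r: "0 < r" and bw: "has_bandwidth B A" and n: "2 ^ 2 ^ (2 * B + 48 * r\<^sup>2) \<le> n"
  shows "\<not> one_round_solves A (mem_detect (complete_graph (r + 2)))
    {G \<in> insertion_networks n. max_degree_le (r + 2) G}"
proof -
  \<comment> \<open>\<open>T\<close>, \<open>W\<close> and \<open>M\<close> are the least values
    above their strict lower bounds; \<open>K\<close> is rounded up so that \<open>E\<close> is the
    only base.\<close>
  define T where "T = 2 ^ Suc B + (1 :: nat)"
  define e where "e = Suc B * ((T * r + 1) * r)"
  define E where "E = (2 :: nat) ^ e"
  define K where "K = E + 1"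
  define W where "W = K * T * E + 1"
  define M where "M = K * T * W * E + 1"
  have "T * 1 \<le> T * r" using r by (intro mult_le_mono) auto
  then have "T * 1 \<le> (T * r + 1) * r" using r by (cases r) auto
  then have T_le: "Suc B * T \<le> e" unfolding e_def by (intro mult_le_mono) auto
  have "3 \<le> T" unfolding T_def by simp
  then have "Suc B * 3 \<le> Suc B * T" by (intro mult_le_mono) auto
  then have B_le: "Suc B * 3 \<le> e" using T_le by linarith
  have "(2 :: nat) ^ (B + 2) \<le> E" unfolding E_def using B_le by (intro power_increasing) auto
  moreover have "T \<le> 2 ^ (B + 2)" unfolding T_def by simp
  ultimately have "T \<le> E" by simp
  have "2 ^ 3 \<le> E" unfolding E_def using B_le by (intro power_increasing) auto
  then have E: "8 \<le> E" by simp
  \<comment> \<open>A sum of two terms costs one more factor \<open>E\<close>; this absorbs the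
    summands 1 in \<open>K\<close>, \<open>W\<close> and \<open>M\<close>.\<close>
  have pow: "E ^ m + E ^ m \<le> E ^ Suc m" for m
  proof -
    have "2 * E ^ m \<le> E * E ^ m" using E by (intro mult_le_mono1) simp
    then show ?thesis unfolding mult_2 power_Suc .
  qed
  have mono: "E ^ a \<le> E ^ b" if "a \<le> b" for a b
    using E that by (intro power_increasing) auto
  have one_le: "1 \<le> E ^ m" for m using E by simp
  have K_le: "K \<le> E\<^sup>2"
    using pow[of 1] one_le[of 1] unfolding K_def by (simp add: numeral_2_eq_2)
  have "K * T * E \<le> E\<^sup>2 * E * E"
    using K_le \<open>T \<le> E\<close> by (intro mult_le_mono) auto
  also have "\<dots> = E ^ 4" by (simp add: eval_nat_numeral)
  finally have W_le: "W \<le> E ^ 5"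
    using pow[of 4] one_le[of 4] unfolding W_def by simp
  have "K * T * W * E \<le> E\<^sup>2 * E * E ^ 5 * E"
    using K_le W_le \<open>T \<le> E\<close> by (intro mult_le_mono) auto
  also have "\<dots> = E ^ 9" by (simp add: eval_nat_numeral)
  finally have M_le: "M \<le> E ^ 10"
    using pow[of 9] one_le[of 9] unfolding M_def by simp
  have "1 * (1 * r) \<le> Suc B * ((T * r + 1) * r)"
    by (intro mult_le_mono) auto
  then have "r \<le> e" unfolding e_def by simp
  also have "e \<le> E" unfolding E_def by (rule less_imp_le[OF less_exp])
  finally have "K * r \<le> E\<^sup>2 * E" using K_le by (intro mult_le_mono)
  also have "\<dots> = E ^ 3" by (simp add: eval_nat_numeral)
  finally have "M + W + K * r \<le> E ^ 10 + E ^ 5 + E ^ 3" using M_le W_le by simp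
  also have "\<dots> \<le> E ^ 10 + (E ^ 5 + E ^ 5)"
    using mono[of 3 5] by simp
  also have "\<dots> \<le> E ^ 10 + E ^ 10"
    using pow[of 5] mono[of 6 10] by simp
  also have "\<dots> \<le> E ^ 12"
    using pow[of 10] mono[of 11 12] by simp
  also have "\<dots> = 2 ^ (12 * e)" unfolding E_def by (simp add: mult.commute flip: power_mult)
  also have "\<dots> \<le> 2 ^ 2 ^ (2 * B + 48 * r\<^sup>2)"
  proof (rule power_increasing)
    have "r * (2 * 1) \<le> r * (2 * 2 ^ B)" by (intro mult_le_mono) auto
    then have "Suc r \<le> r * (2 * 2 ^ B)" using r by linarith
    then have "T * r + 1 \<le> 2 ^ (B + 2) * r"
      unfolding T_def by (simp add: algebra_simps)
    moreover have "Suc B \<le> 2 ^ B" using less_exp[of B] by (simp add: Suc_leI)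
    ultimately have "e \<le> 2 ^ B * (2 ^ (B + 2) * r * r)"
      unfolding e_def by (intro mult_le_mono) auto
    moreover have "(2 :: nat) ^ (2 * B) = 2 ^ B * 2 ^ B" by (metis mult_2 power_add)
    \<comment> \<open>The factor 48 is 12, from \<open>E ^ 12\<close>, times 4, from
      \<open>2 ^ (B + 2)\<close>.\<close>
    ultimately have "12 * e \<le> 2 ^ (2 * B) * (48 * r\<^sup>2)"
      by (simp add: power_add power2_eq_square mult_ac)
    also have "\<dots> \<le> 2 ^ (2 * B) * 2 ^ (48 * r\<^sup>2)"
      by (intro mult_le_mono2 less_imp_le[OF less_exp])
    finally show "12 * e \<le> 2 ^ (2 * B + 48 * r\<^sup>2)" by (simp add: power_add)
  qed simp
  finally have n_ge: "M + W + K * r \<le> n" using n by simp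
  define D where "D = Outer ` {..<M + W} \<union> (\<lambda>(k, a). Core k a) ` ({..<K} \<times> {..<r})"
  have "card D \<le> card (Outer ` {..<M + W}) + card ((\<lambda>(k, a). Core k a) ` ({..<K} \<times> {..<r}))"
    unfolding D_def by (rule card_Un_le)
  also have "\<dots> \<le> (M + W) + K * r"
    using card_image_le[of "{..<M + W}" Outer]
      card_image_le[of "{..<K} \<times> {..<r}" "\<lambda>(k, a). Core k a"] by (simp add: add_mono)
  finally have "card D \<le> n" using n_ge by simp
  then obtain nd :: "node \<Rightarrow> nat" where nd: "inj nd" "nd ` D \<subseteq> {1..n}"
    using inj_into_interval[of D n] unfolding D_def by auto
  interpret core_networks n r K M W T nd
  proof
    show "nd (Outer x) \<in> {1..n}" if "x < M + W" for x
      using nd(2) that unfolding D_def by blast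
    show "nd (Core k a) \<in> {1..n}" if "k < K" "a < r" for k a
      using nd(2) that unfolding D_def by force
  qed (use r nd(1) in auto)
  have "2 ^ (Suc B * T) \<le> E" unfolding E_def using T_le by (intro power_increasing) auto
  then have "2 ^ (Suc B * T) < K" unfolding K_def by simp
  then show ?thesis
    by (intro not_one_round_solves[OF bw])
      (simp_all add: T_def W_def M_def E_def e_def)
qed

text \<open>The infimum of a nonempty set of \<open>enat\<close> is attained, and that of the empty
  set is infinite.\<close>

lemma ereal_le_Inf_enat:
  assumes "\<And>B. P B \<Longrightarrow> x \<le> real B"
  shows "ereal x \<le> ereal_of_enat (Inf {enat B | B. P B})"
proof (cases "\<exists>B. P B")
  case True
  then obtain B where "enat B \<in> {enat B | B. P B}" by blast
  then have "Inf {enat B | B. P B} \<in> {enat B | B. P B}" by (rule wellorder_InfI)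
  then obtain B where "Inf {enat B | B. P B} = enat B" "P B" by auto
  then show ?thesis using assms by simp
next
  case False
  then have "Inf {enat B | B. P B} = \<infinity>" by (simp add: top_enat_def[symmetric])
  then show ?thesis by simp
qed

text \<open>An algorithm for a class of networks also works on every subclass. Stated for all
  classes above the one of degree at most \<open>s\<close>, the bound covers both halves of the
  theorem.\<close>

lemma enat_bigomega_one_round_bandwidth:
  fixes s :: nat
  assumes "s \<ge> 3" and sub: "\<And>n. {G \<in> insertion_networks n. max_degree_le s G} \<subseteq> \<G> n"
  shows "enat_bigomega (\<lambda>n. one_round_bandwidth (mem_detect (complete_graph s)) (\<G> n))
    (\<lambda>n. log 2 (log 2 (real n)))"
proof -
  define r where "r = s - 2"
  have s: "s = r + 2" "0 < r" using assms(1) unfolding r_def by auto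
  define C where "C = 48 * r\<^sup>2"
  have bound: "log 2 (log 2 (real n)) \<le> 4 * real B"
    if n: "2 ^ 2 ^ (2 * C) \<le> n" and bw: "has_bandwidth B A"
      and solves: "one_round_solves A (mem_detect (complete_graph s)) (\<G> n)" for n B A
  proof -
    have "one_round_solves A (mem_detect (complete_graph (r + 2)))
        {G \<in> insertion_networks n. max_degree_le (r + 2) G}"
      using solves sub[of n] unfolding one_round_solves_def s(1) by blast
    then have "n < 2 ^ 2 ^ (2 * B + C)"
      using not_one_round_solves_large_n[OF s(2) bw] unfolding C_def by (meson not_le)
    then have n': "real n < 2 ^ 2 ^ (2 * B + C)"
      by (metis of_nat_less_iff of_nat_numeral of_nat_power)
    have "(2 :: real) ^ 2 ^ (2 * C) \<le> real n"
      using n by (metis of_nat_le_iff of_nat_numeral of_nat_power)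
    then have "log 2 (2 ^ 2 ^ (2 * C)) \<le> log 2 (real n)"
      by (subst log_le_cancel_iff) (auto intro: less_le_trans[of 0 "2 ^ 2 ^ (2 * C)"])
    then have l: "2 ^ (2 * C) \<le> log 2 (real n)" by (simp add: log_nat_power)
    then have pos: "0 < log 2 (real n)" by (auto intro: less_le_trans[of 0 "2 ^ (2 * C)"])
    have "0 < n" using n by (rule less_le_trans[rotated]) simp
    with n' have "log 2 (real n) < log 2 (2 ^ 2 ^ (2 * B + C))"
      by (subst log_less_cancel_iff) auto
    then have "log 2 (real n) < 2 ^ (2 * B + C)" by (simp add: log_nat_power)
    with pos have "log 2 (log 2 (real n)) < log 2 (2 ^ (2 * B + C))"
      by (subst log_less_cancel_iff) auto
    then have upper: "log 2 (log 2 (real n)) < 2 * real B + real C" by (simp add: log_nat_power)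
    have "log 2 (2 ^ (2 * C)) \<le> log 2 (log 2 (real n))"
      using l pos by (subst log_le_cancel_iff) auto
    then have "2 * real C \<le> log 2 (log 2 (real n))" by (simp add: log_nat_power)
    \<comment> \<open>Writing \<open>L\<close> for the iterated logarithm,
      \<open>L < 2 * B + C\<close> and \<open>C \<le> L / 2\<close> give \<open>L < 4 * B\<close>.
      The threshold on \<open>n\<close> is chosen for the second inequality.\<close>
    then show ?thesis using upper by linarith
  qed
  have "ereal (1 / 4 * \<bar>log 2 (log 2 (real n))\<bar>) \<le>
      ereal_of_enat (one_round_bandwidth (mem_detect (complete_graph s)) (\<G> n))"
    if n: "2 ^ 2 ^ (2 * C) \<le> n" for n
  proof -
    \<comment> \<open>For \<open>n \<ge> 2\<close> the iterated logarithm is nonnegative, so the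
      absolute value disappears.\<close>
    have "(2 :: nat) ^ 1 \<le> 2 ^ 2 ^ (2 * C)" by (intro power_increasing) auto
    then have "2 \<le> n" using n by (metis le_trans power_one_right)
    then have "2 \<le> real n" by simp
    then have "1 \<le> log 2 (real n)" by (simp add: le_log_iff)
    then have "0 \<le> log 2 (log 2 (real n))" by simp
    then show ?thesis
      unfolding one_round_bandwidth_def using bound[OF n] by (intro ereal_le_Inf_enat) fastforce
  qed
  then show ?thesis
    unfolding enat_bigomega_def eventually_sequentially by (intro exI[of _ "1 / 4"]) auto
qed

theorem theorem1p3:
  fixes s :: nat
  assumes "s \<ge> 3"
  shows "enat_bigomega
           (\<lambda>n. one_round_bandwidth (mem_detect (complete_graph s)) (insertion_networks n))
           (\<lambda>n. log 2 (log 2 (real n))) \<and>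
         (\<exists>\<Delta>. enat_bigomega
           (\<lambda>n. one_round_bandwidth (mem_detect (complete_graph s))
                  {G \<in> insertion_networks n. max_degree_le \<Delta> G})
           (\<lambda>n. log 2 (log 2 (real n))))"
  \<comment> \<open>The degree bound \<open>\<Delta>\<close> is \<open>s\<close> itself.\<close>
  using enat_bigomega_one_round_bandwidth[OF assms, of insertion_networks]
    enat_bigomega_one_round_bandwidth[OF assms,
      of "\<lambda>n. {G \<in> insertion_networks n. max_degree_le s G}"]
  by blast
end
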